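(* Consider, for $s\in\mathbb{C}$, the inequality $$|s|\le\left|\frac{s+1}{2}\right|^2. \qquad ( * )$$ (1) In the complex plane there exists a closed bounded curve on which equality is attained in $( * )$; outside this curve the inequality $( * )$ holds, and in the bounded region inside the curve the reverse inequality holds. With $s=x+iy$, $x,y\in\mathbb{R}$, this curve is defined by the equation $$x^4+y^4+2x^2y^2+4x^3+4xy^2-10x^2-14y^2+4x+1=0.$$ (2) For real $s$, inequality $( * )$ holds not only for $s>0$, as one would expect, but for $s\in(-\infty,-3-2\sqrt2]\cup[-3+2\sqrt2,\infty)$. (3) For purely imaginary $s$, inequality $( * )$ holds for $\operatorname{Im}(s)\in(-\infty,-2-\sqrt3]\cup[-2+\sqrt3,\,2-\sqrt3]\cup[2+\sqrt3,\infty)$. (4) In polar coordinates $s=re^{i\phi}$, the equations of the outer and inner curves have the form $$r=2-\cos\phi\pm\sqrt{(2-\cos\phi)^2-1}.$$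
   Context: For complex $z,w$ with $z\neq 0$, inequality $( * )$ is the complex-modulus version $|zw|\le\left|\frac{z+w}{2}\right|^2$ of the squared inequality between the geometric and arithmetic means, rewritten by homogeneity in the variable $s=w/z$. In item (4), the outer and inner curves are the two parts (sign $+$ and sign $-$ respectively) of the curve from item (1). *)

theory Defs
  imports "HOL-Complex_Analysis.Complex_Analysis"
begin

definition mean_ineq :: "complex \<Rightarrow> bool" where
  "mean_ineq s \<longleftrightarrow> norm s \<le> (norm ((s + 1) / 2))\<^sup>2"

definition closed_curve :: "(real \<Rightarrow> complex) \<Rightarrow> bool" where
  "closed_curve \<gamma> \<longleftrightarrow> path \<gamma> \<and> pathfinish \<gamma> = pathstart \<gamma>"

(* The curve {s. norm s = (norm ((s + 1) / 2))^2} is not a Jordan curve: it consists of an outer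
   and an inner loop that meet at s = 1, and the reverse inequality holds only between them,
   not inside the inner loop (at s = 0, say).  The topological notion inside (union of all bounded
   components of the complement) would include the inner loop's interior, so for a closed curve
   that need not be simple, inside and outside are taken in the sense of winding numbers. *)

definition curve_interior :: "(real \<Rightarrow> complex) \<Rightarrow> complex set" where
  "curve_interior \<gamma> = {z. z \<notin> path_image \<gamma> \<and> winding_number \<gamma> z \<noteq> 0}"

definition curve_exterior :: "(real \<Rightarrow> complex) \<Rightarrow> complex set" where
  "curve_exterior \<gamma> = {z. z \<notin> path_image \<gamma> \<and> winding_number \<gamma> z = 0}"

end

theory Submission imports Defs begin

text \<open>
  Write \<open>s = r u\<close> with \<open>r \<ge> 0\<close> and \<open>\<bar>u\<bar> = 1\<close>.  Since \<open>\<bar>s + 1\<bar>\<^sup>2 = r\<^sup>2 + 2 r Re u + 1\<close>, the inequality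
  says that \<open>r\<^sup>2 - 2 (2 - Re u) r + 1 \<ge> 0\<close>.  As \<open>2 - Re u \<ge> 1\<close>, this quadratic in \<open>r\<close> has two positive
  roots, the inner and the outer radius, with product \<open>1\<close>, and the inequality fails exactly strictly
  between them.  Everything about the plane curve follows from this description.

  Each of the two radii is a continuous positive function on the unit circle, so its graph in polar
  coordinates is a loop that is star-shaped about \<open>0\<close>.  For such loops the Jordan curve theorem is
  elementary: the points below the radius form a connected bounded set, those above it a connected
  unbounded one, and lifting the loop through the exponential function shows that it winds once around
  \<open>0\<close>, hence once around every point below the radius.  This is the content of the locale
  \<open>star_shaped_loop\<close>.

  The closed curve is the outer loop followed by the inner loop run backwards; they can be joined
  because both start at \<open>1\<close>, where the two radii agree.  Its winding number is \<open>1 - 1 = 0\<close> inside the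
  inner loop, \<open>1 - 0 = 1\<close> between the loops and \<open>0 - 0 = 0\<close> outside the outer loop.  The region
  between the loops is connected because it is parametrised by an open angle interval, cut at the
  common point \<open>1\<close>, and a position strictly between the two radii; it is a whole component of the
  complement because the winding number is constant on connected sets.
\<close>

section \<open>Loops that are star-shaped about the origin\<close>

text \<open>
  Taking the radius as a function of the direction \<open>u\<close> rather than of an angle makes periodicity in
  the angle automatic.
\<close>

locale star_shaped_loop =
  fixes \<sigma> :: "complex \<Rightarrow> real"
  assumes continuous: "continuous_on (sphere 0 1) \<sigma>"
    and pos: "norm u = 1 \<Longrightarrow> 0 < \<sigma> u"
begin

definition loop :: "real \<Rightarrow> complex" where
  "loop t = of_real (\<sigma> (cis (2 * pi * t))) * cis (2 * pi * t)"

lemma continuous_radius_cis: "continuous_on A (\<lambda>t. \<sigma> (cis (2 * pi * t)))"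
  by (rule continuous_on_compose2[OF continuous]) (auto intro!: continuous_intros)

lemma path_loop: "path loop"
  unfolding path_def loop_def by (intro continuous_intros continuous_radius_cis)

lemma loop_closed: "pathfinish loop = pathstart loop"
  by (simp add: pathfinish_def pathstart_def loop_def cis.ctr complex_eq_iff)

lemma norm_loop: "norm (loop t) = \<sigma> (cis (2 * pi * t))"
  using pos[of "cis (2 * pi * t)"] by (simp add: loop_def norm_mult)

lemma unit_vector_as_cis:
  assumes "norm u = 1"
  obtains t where "0 \<le> t" "t < 1" "u = cis (2 * pi * t)"
proof
  show "0 \<le> Arg2pi u / (2 * pi)" "Arg2pi u / (2 * pi) < 1"
    by (simp_all add: Arg2pi_ge_0 Arg2pi_lt_2pi)
  show "u = cis (2 * pi * (Arg2pi u / (2 * pi)))"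
    using Arg2pi_eq[of u] assms by (simp add: cis_conv_exp)
qed

lemma in_loop_iff:
  assumes "0 \<le> r" "norm u = 1"
  shows "of_real r * u \<in> path_image loop \<longleftrightarrow> r = \<sigma> u"
proof
  assume "of_real r * u \<in> path_image loop"
  then obtain t where t: "of_real r * u = loop t"
    unfolding path_image_def by auto
  have r: "r = \<sigma> (cis (2 * pi * t))"
    using arg_cong[OF t, of norm] assms by (simp add: norm_loop norm_mult)
  moreover have "r > 0" using pos[of "cis (2 * pi * t)"] r by simp
  ultimately have "u = cis (2 * pi * t)"
    using t by (simp add: loop_def)
  with r show "r = \<sigma> u" by simp
next
  assume r: "r = \<sigma> u"
  obtain t where "0 \<le> t" "t < 1" "u = cis (2 * pi * t)"
    using unit_vector_as_cis[OF assms(2)] .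
  then show "of_real r * u \<in> path_image loop"
    using r by (auto simp: path_image_def loop_def intro!: image_eqI[of _ _ t])
qed

lemma simple_path_loop: "simple_path loop"
  unfolding simple_path_def loop_free_def
proof (intro conjI ballI impI path_loop)
  fix x y :: real
  assume xy: "x \<in> {0..1}" "y \<in> {0..1}" and eq: "loop x = loop y"
  have "\<sigma> (cis (2 * pi * x)) = \<sigma> (cis (2 * pi * y))"
    using arg_cong[OF eq, of norm] by (simp add: norm_loop)
  then have "cis (2 * pi * x) = cis (2 * pi * y)"
    using eq pos[of "cis (2 * pi * y)"] by (simp add: loop_def)
  then have "cis (2 * pi * x - 2 * pi * y) = 1"
    by (simp flip: cis_divide)
  then have "cos (2 * pi * x - 2 * pi * y) = 1"
    by (simp add: complex_eq_iff)
  then obtain n :: int where "2 * pi * x - 2 * pi * y = of_int n * 2 * pi"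
    unfolding cos_one_2pi_int by blast
  then have "2 * pi * (x - y) = 2 * pi * of_int n" by (simp add: algebra_simps)
  then have n: "x - y = of_int n" by (simp only: mult_cancel_left) simp
  then have "-1 \<le> n" "n \<le> 1" using xy by auto
  then consider "n = -1" | "n = 0" | "n = 1" by linarith
  then show "x = y \<or> x = 0 \<and> y = 1 \<or> x = 1 \<and> y = 0"
    by cases (use n xy in auto)
qed

definition below :: "complex set" where
  "below = {of_real r * u | r u. 0 \<le> r \<and> norm u = 1 \<and> r < \<sigma> u}"

definition above :: "complex set" where
  "above = {of_real r * u | r u. norm u = 1 \<and> \<sigma> u < r}"

lemma polar_decomposition:
  obtains r u where "0 \<le> r" "norm u = 1" "z = of_real r * (u :: complex)"
proof
  show "0 \<le> norm z" by simp
  show "norm (if z = 0 then 1 else sgn z) = 1" by (simp add: norm_sgn)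
  show "z = of_real (norm z) * (if z = 0 then 1 else sgn z)" by (simp add: sgn_eq)
qed

lemma below_disjoint: "below \<inter> path_image loop = {}"
  unfolding below_def using in_loop_iff by force

lemma above_disjoint: "above \<inter> path_image loop = {}"
proof -
  have "of_real r * u \<notin> path_image loop" if "norm u = 1" "\<sigma> u < r" for r u
    using in_loop_iff[of r u] pos[OF that(1)] that by simp
  then show ?thesis unfolding above_def by blast
qed

lemma zero_in_below: "0 \<in> below"
proof -
  have "of_real 0 * 1 \<in> below"
    unfolding below_def using pos[of 1] norm_one by blast
  then show ?thesis by simp
qed

lemma connected_below: "connected below"
proof (rule starlike_imp_connected)
  have "closed_segment 0 z \<subseteq> below" if z: "z \<in> below" for z
  proof
    fix w assume "w \<in> closed_segment 0 z"
    then obtain a where a: "0 \<le> a" "a \<le> 1" "w = a *\<^sub>R z"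
      by (auto simp: in_segment)
    obtain r u where r: "z = of_real r * u" "0 \<le> r" "norm u = 1" "r < \<sigma> u"
      using z unfolding below_def by blast
    have "a * r \<le> 1 * r" using a r by (intro mult_right_mono) auto
    then have "0 \<le> a * r" "a * r < \<sigma> u" "w = of_real (a * r) * u"
      using a r by (auto simp: scaleR_conv_of_real)
    then show "w \<in> below" unfolding below_def using r(3) by blast
  qed
  then show "starlike below"
    unfolding starlike_def using zero_in_below by blast
qed

lemma connected_above: "connected above"
proof -
  have eq: "above = (\<lambda>(u, t). of_real (\<sigma> u + t) * u) ` (sphere 0 1 \<times> {0<..})"
  proof (intro equalityI subsetI)
    fix z assume "z \<in> above"
    then obtain r u where "z = of_real r * u" "norm u = 1" "\<sigma> u < r"
      unfolding above_def by blast
    then show "z \<in> (\<lambda>(u, t). of_real (\<sigma> u + t) * u) ` (sphere 0 1 \<times> {0<..})"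
      by (intro image_eqI[of _ _ "(u, r - \<sigma> u)"]) auto
  next
    fix z assume "z \<in> (\<lambda>(u, t). of_real (\<sigma> u + t) * u) ` (sphere 0 1 \<times> {0<..})"
    then obtain u t where ut: "norm u = 1" "0 < t" "z = of_real (\<sigma> u + t) * u" by auto
    then have "\<sigma> u < \<sigma> u + t" by simp
    with ut show "z \<in> above" unfolding above_def by blast
  qed
  have "continuous_on (sphere 0 1 \<times> {0<..}) (\<lambda>p. \<sigma> (fst p))"
    by (rule continuous_on_compose2[OF continuous]) (auto intro!: continuous_intros)
  then have "continuous_on (sphere 0 1 \<times> {0<..}) (\<lambda>(u, t). of_real (\<sigma> u + t) * u)"
    unfolding case_prod_unfold by (intro continuous_intros)
  moreover have "connected (sphere (0::complex) 1 \<times> {0::real<..})"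
    by (intro connected_Times connected_sphere) auto
  ultimately show ?thesis unfolding eq by (rule connected_continuous_image)
qed

lemma unbounded_above: "\<not> bounded above"
proof
  assume "bounded above"
  then obtain B where B: "\<And>z. z \<in> above \<Longrightarrow> norm z \<le> B" unfolding bounded_iff by blast
  define r where "r = max (\<sigma> 1) B + 1"
  have "\<sigma> 1 < r" by (simp add: r_def)
  then have "of_real r * 1 \<in> above"
    unfolding above_def using norm_one by blast
  then have "norm (of_real r :: complex) \<le> B" using B by fastforce
  then show False by (simp add: r_def)
qed

lemma above_subset_outside: "above \<subseteq> outside (path_image loop)"
proof
  fix z assume z: "z \<in> above"
  have "above \<subseteq> connected_component_set (- path_image loop) z"
    using z connected_above above_disjoint by (intro connected_component_maximal) auto
  then have "\<not> bounded (connected_component_set (- path_image loop) z)"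
    using unbounded_above bounded_subset by blast
  then show "z \<in> outside (path_image loop)" by (simp add: outside)
qed

text \<open>
  The loop is the exponential of a path whose imaginary part grows by \<open>2 \<pi>\<close> and whose real part, the
  logarithm of the radius, returns to its starting value.
\<close>

lemma winding_number_zero: "winding_number loop 0 = 1"
proof -
  define p where "p t = of_real (ln (\<sigma> (cis (2 * pi * t)))) + \<i> * of_real (2 * pi * t)" for t
  have nz: "\<sigma> (cis (2 * pi * t)) \<noteq> 0" for t using pos[of "cis (2 * pi * t)"] by simp
  have "path p"
    unfolding path_def p_def using nz by (intro continuous_intros continuous_radius_cis) auto
  moreover have "exp \<circ> p = loop"
  proof
    fix t
    have "exp (of_real (ln (\<sigma> (cis (2 * pi * t)))) :: complex) = of_real (\<sigma> (cis (2 * pi * t)))"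
      using pos[of "cis (2 * pi * t)"] by (simp add: exp_of_real)
    then show "(exp \<circ> p) t = loop t"
      by (simp add: p_def loop_def exp_add cis_conv_exp)
  qed
  moreover have "pathfinish p - pathstart p = 2 * of_real pi * \<i>"
    by (simp add: pathfinish_def pathstart_def p_def cis.ctr one_complex.ctr)
  ultimately show ?thesis
    using winding_number_compose_exp[of p] by simp
qed

lemma winding_number_below:
  assumes "z \<in> below" shows "winding_number loop z = 1"
  using winding_number_eq[OF path_loop loop_closed assms zero_in_below connected_below below_disjoint]
  by (simp add: winding_number_zero)

lemma winding_number_above:
  assumes "z \<in> above" shows "winding_number loop z = 0"
  using winding_number_zero_in_outside[OF path_loop loop_closed] above_subset_outside assms by blast

text \<open>
  A winding number different from \<open>0\<close> keeps a point out of the unbounded component, so the boundedness of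
  its component comes for free.
\<close>

lemma below_subset_inside: "below \<subseteq> inside (path_image loop)"
proof
  fix z assume z: "z \<in> below"
  then have "z \<notin> outside (path_image loop)"
    using winding_number_below winding_number_zero_in_outside[OF path_loop loop_closed] by force
  then show "z \<in> inside (path_image loop)"
    using z below_disjoint inside_Un_outside[of "path_image loop"] by blast
qed

lemma polar_cases:
  assumes "0 \<le> r" "norm u = 1"
  shows "of_real r * u \<in> below \<and> r < \<sigma> u \<or> of_real r * u \<in> path_image loop \<and> r = \<sigma> u
    \<or> of_real r * u \<in> above \<and> \<sigma> u < r"
  using in_loop_iff[OF assms] assms unfolding below_def above_def
  by (cases r "\<sigma> u" rule: linorder_cases) auto

lemma in_inside_iff:
  assumes "0 \<le> r" "norm u = 1"
  shows "of_real r * u \<in> inside (path_image loop) \<longleftrightarrow> r < \<sigma> u"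
  using polar_cases[OF assms] below_subset_inside above_subset_outside
    inside_no_overlap[of "path_image loop"] inside_Int_outside[of "path_image loop"]
  by (metis disjoint_iff order.asym order.irrefl subset_iff)

lemma in_outside_iff:
  assumes "0 \<le> r" "norm u = 1"
  shows "of_real r * u \<in> outside (path_image loop) \<longleftrightarrow> \<sigma> u < r"
  using polar_cases[OF assms] below_subset_inside above_subset_outside
    outside_no_overlap[of "path_image loop"] inside_Int_outside[of "path_image loop"]
  by (metis disjoint_iff order.asym order.irrefl subset_iff)

lemma winding_number_polar:
  assumes "0 \<le> r" "norm u = 1" "r \<noteq> \<sigma> u"
  shows "winding_number loop (of_real r * u) = (if r < \<sigma> u then 1 else 0)"
  using polar_cases[OF assms(1,2)] assms(3) winding_number_below winding_number_above by auto

end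

section \<open>The inner and the outer radius\<close>

definition outer_radius :: "complex \<Rightarrow> real" where
  "outer_radius u = 2 - Re u + sqrt ((2 - Re u)\<^sup>2 - 1)"

definition inner_radius :: "complex \<Rightarrow> real" where
  "inner_radius u = 2 - Re u - sqrt ((2 - Re u)\<^sup>2 - 1)"

lemma discriminant_nonneg:
  assumes "norm u = 1" shows "0 \<le> (2 - Re u)\<^sup>2 - 1"
proof -
  have "1 \<le> 2 - Re u" using complex_Re_le_cmod[of u] assms by simp
  then show ?thesis using one_le_power[of "2 - Re u" 2] by simp
qed

lemma radii_sum: "inner_radius u + outer_radius u = 2 * (2 - Re u)"
  by (simp add: inner_radius_def outer_radius_def)

lemma radii_product:
  assumes "norm u = 1" shows "inner_radius u * outer_radius u = 1"
proof -
  have "inner_radius u * outer_radius u = (2 - Re u)\<^sup>2 - (sqrt ((2 - Re u)\<^sup>2 - 1))\<^sup>2"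
    unfolding inner_radius_def outer_radius_def by algebra
  then show ?thesis using discriminant_nonneg[OF assms] by simp
qed

lemma inner_le_outer:
  assumes "norm u = 1" shows "inner_radius u \<le> outer_radius u"
  using discriminant_nonneg[OF assms] by (simp add: inner_radius_def outer_radius_def)

lemma inner_less_outer:
  assumes "norm u = 1" "u \<noteq> 1" shows "inner_radius u < outer_radius u"
proof -
  have "Re u \<noteq> 1"
    using assms cmod_power2[of u] by (auto simp: complex_eq_iff)
  then have "1 < 2 - Re u" using complex_Re_le_cmod[of u] assms by simp
  then have "0 < (2 - Re u)\<^sup>2 - 1" using one_less_power[of "2 - Re u" 2] by simp
  then show ?thesis by (simp add: inner_radius_def outer_radius_def)
qed

lemma outer_radius_pos:
  assumes "norm u = 1" shows "0 < outer_radius u"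
  using discriminant_nonneg[OF assms] complex_Re_le_cmod[of u] assms
  by (simp add: outer_radius_def add_pos_nonneg)

lemma inner_radius_pos:
  assumes "norm u = 1" shows "0 < inner_radius u"
  using radii_product[OF assms] outer_radius_pos[OF assms]
  by (metis zero_less_mult_pos2 zero_less_one)

lemma continuous_on_radii:
  "continuous_on A outer_radius" "continuous_on A inner_radius"
  unfolding outer_radius_def[abs_def] inner_radius_def[abs_def] by (intro continuous_intros)+

interpretation outer: star_shaped_loop outer_radius
  by unfold_locales (simp_all add: outer_radius_pos continuous_on_radii)

interpretation inner: star_shaped_loop inner_radius
  by unfold_locales (simp_all add: inner_radius_pos continuous_on_radii)

text \<open>
  The two sides of the inequality differ by a quarter of the quadratic polynomial whose roots are the two
  radii, so every comparison between them is a statement about the position of \<open>r\<close>.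
\<close>

lemma radius_gap:
  assumes "0 \<le> r" "norm u = 1"
  shows "(norm ((of_real r * u + 1) / 2))\<^sup>2 - norm (of_real r * u)
    = (r - inner_radius u) * (r - outer_radius u) / 4"
proof -
  have u: "(Re u)\<^sup>2 + (Im u)\<^sup>2 = 1" using assms(2) cmod_power2[of u] by simp
  have "(norm (of_real r * u + 1))\<^sup>2 = (r * Re u + 1)\<^sup>2 + (r * Im u)\<^sup>2"
    by (simp add: cmod_power2)
  also have "\<dots> = r\<^sup>2 * ((Re u)\<^sup>2 + (Im u)\<^sup>2) + 2 * r * Re u + 1" by algebra
  finally have "(norm ((of_real r * u + 1) / 2))\<^sup>2 = (r\<^sup>2 + 2 * r * Re u + 1) / 4"
    using u by (simp add: norm_divide power_divide)
  moreover have "(r - inner_radius u) * (r - outer_radius u) = r\<^sup>2 - r * (2 * (2 - Re u)) + 1"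
    unfolding radii_sum[symmetric] radii_product[OF assms(2), symmetric] by algebra
  ultimately show ?thesis using assms by (simp add: norm_mult field_simps)
qed

lemma equality_iff:
  assumes "0 \<le> r" "norm u = 1"
  shows "norm (of_real r * u) = (norm ((of_real r * u + 1) / 2))\<^sup>2
    \<longleftrightarrow> r = inner_radius u \<or> r = outer_radius u"
  using radius_gap[OF assms] by auto

lemma mean_ineq_if_not_between:
  assumes "0 \<le> r" "norm u = 1" "r \<le> inner_radius u \<or> outer_radius u \<le> r"
  shows "mean_ineq (of_real r * u)"
proof -
  have "0 \<le> (r - inner_radius u) * (r - outer_radius u)"
    using assms inner_le_outer[OF assms(2)] by (auto simp: zero_le_mult_iff)
  then show ?thesis using radius_gap[OF assms(1,2)] by (simp add: mean_ineq_def)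
qed

lemma reverse_ineq_if_between:
  assumes "0 \<le> r" "norm u = 1" "inner_radius u < r" "r < outer_radius u"
  shows "(norm ((of_real r * u + 1) / 2))\<^sup>2 \<le> norm (of_real r * u)"
proof -
  have "(r - inner_radius u) * (r - outer_radius u) \<le> 0"
    using assms by (auto simp: mult_le_0_iff)
  then show ?thesis using radius_gap[OF assms(1,2)] by simp
qed

text \<open>
  Both sides of the equality are nonnegative, so it may be squared without adding solutions.
\<close>

lemma equality_cartesian:
  "norm (Complex x y) = (norm ((Complex x y + 1) / 2))\<^sup>2 \<longleftrightarrow>
     x^4 + y^4 + 2 * x^2 * y^2 + 4 * x^3 + 4 * x * y^2 - 10 * x^2 - 14 * y^2 + 4 * x + 1 = 0"
proof -
  have q: "(norm ((Complex x y + 1) / 2))\<^sup>2 = ((x + 1)\<^sup>2 + y\<^sup>2) / 4"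
    by (simp add: norm_divide power_divide cmod_power2)
  have "norm (Complex x y) = ((x + 1)\<^sup>2 + y\<^sup>2) / 4
      \<longleftrightarrow> (norm (Complex x y))\<^sup>2 = (((x + 1)\<^sup>2 + y\<^sup>2) / 4)\<^sup>2"
    by (subst power2_eq_iff_nonneg) auto
  also have "\<dots> \<longleftrightarrow> 16 * (x\<^sup>2 + y\<^sup>2) = ((x + 1)\<^sup>2 + y\<^sup>2)\<^sup>2"
    by (auto simp: cmod_power2 power_divide)
  also have "\<dots> \<longleftrightarrow> ((x + 1)\<^sup>2 + y\<^sup>2)\<^sup>2 - 16 * (x\<^sup>2 + y\<^sup>2) = 0" by auto
  also have "((x + 1)\<^sup>2 + y\<^sup>2)\<^sup>2 - 16 * (x\<^sup>2 + y\<^sup>2)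
      = x^4 + y^4 + 2 * x^2 * y^2 + 4 * x^3 + 4 * x * y^2 - 10 * x^2 - 14 * y^2 + 4 * x + 1"
    by algebra
  finally show ?thesis unfolding q .
qed

section \<open>The composite curve\<close>

text \<open>
  Reversing the inner loop is what makes the winding number vanish inside it.
\<close>

definition mean_curve :: "real \<Rightarrow> complex" where
  "mean_curve = outer.loop +++ reversepath inner.loop"

lemma loops_meet: "pathfinish outer.loop = pathstart (reversepath inner.loop)"
  by (simp add: pathstart_def pathfinish_def reversepath_def outer.loop_def inner.loop_def
      outer_radius_def inner_radius_def)

lemma path_image_mean_curve:
  "path_image mean_curve = path_image outer.loop \<union> path_image inner.loop"
  unfolding mean_curve_def by (simp add: path_image_join loops_meet)

lemma closed_mean_curve: "closed_curve mean_curve"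
  using outer.path_loop inner.path_loop loops_meet outer.loop_closed inner.loop_closed
  by (simp add: closed_curve_def mean_curve_def)

lemma in_mean_curve_iff:
  assumes "0 \<le> r" "norm u = 1"
  shows "of_real r * u \<in> path_image mean_curve \<longleftrightarrow> r = inner_radius u \<or> r = outer_radius u"
  using inner.in_loop_iff[OF assms] outer.in_loop_iff[OF assms]
  by (auto simp: path_image_mean_curve)

lemma path_image_mean_curve_eq:
  "path_image mean_curve = {s. norm s = (norm ((s + 1) / 2))\<^sup>2}"
proof -
  have "s \<in> path_image mean_curve \<longleftrightarrow> norm s = (norm ((s + 1) / 2))\<^sup>2" for s
  proof -
    obtain r u where "0 \<le> r" "norm u = 1" "s = of_real r * u"
      using outer.polar_decomposition .
    then show ?thesis using in_mean_curve_iff equality_iff by metis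
  qed
  then show ?thesis by blast
qed

lemma winding_number_mean_curve:
  assumes "0 \<le> r" "norm u = 1" "of_real r * u \<notin> path_image mean_curve"
  shows "winding_number mean_curve (of_real r * u)
    = (if inner_radius u < r \<and> r < outer_radius u then 1 else 0)"
proof -
  have ne: "r \<noteq> inner_radius u" "r \<noteq> outer_radius u"
    using assms in_mean_curve_iff by auto
  have "winding_number mean_curve (of_real r * u)
      = winding_number outer.loop (of_real r * u) - winding_number inner.loop (of_real r * u)"
    using assms outer.path_loop inner.path_loop loops_meet
    by (simp add: path_image_mean_curve)
       (simp add: mean_curve_def winding_number_join winding_number_reversepath)
  then show ?thesis
    using outer.winding_number_polar[OF assms(1,2)] inner.winding_number_polar[OF assms(1,2)] ne
      inner_le_outer[OF assms(2)] by auto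
qed

lemma in_curve_interior_iff:
  assumes "0 \<le> r" "norm u = 1"
  shows "of_real r * u \<in> curve_interior mean_curve \<longleftrightarrow> inner_radius u < r \<and> r < outer_radius u"
  using winding_number_mean_curve[OF assms] in_mean_curve_iff[OF assms]
  by (auto simp: curve_interior_def split: if_splits)

lemma in_curve_exterior_imp:
  assumes "0 \<le> r" "norm u = 1" "of_real r * u \<in> curve_exterior mean_curve"
  shows "r \<le> inner_radius u \<or> outer_radius u \<le> r"
  using winding_number_mean_curve[OF assms(1,2)] assms(3)
  by (auto simp: curve_exterior_def split: if_splits)

lemma curve_interior_eq:
  "curve_interior mean_curve = inside (path_image outer.loop) \<inter> outside (path_image inner.loop)"
proof -
  have "s \<in> curve_interior mean_curve
      \<longleftrightarrow> s \<in> inside (path_image outer.loop) \<inter> outside (path_image inner.loop)" for s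
  proof -
    obtain r u where ru: "0 \<le> r" "norm u = 1" "s = of_real r * u"
      using outer.polar_decomposition .
    show ?thesis
      unfolding ru(3) Int_iff in_curve_interior_iff[OF ru(1,2)] outer.in_inside_iff[OF ru(1,2)]
        inner.in_outside_iff[OF ru(1,2)] by blast
  qed
  then show ?thesis by blast
qed

lemma inside_inner_subset: "inside (path_image inner.loop) \<subseteq> inside (path_image outer.loop)"
proof
  fix s assume s: "s \<in> inside (path_image inner.loop)"
  obtain r u where ru: "0 \<le> r" "norm u = 1" "s = of_real r * u"
    using outer.polar_decomposition .
  then show "s \<in> inside (path_image outer.loop)"
    using s inner.in_inside_iff[OF ru(1,2)] outer.in_inside_iff[OF ru(1,2)]
      inner_le_outer[OF ru(2)] by simp
qed

text \<open>
  In the direction \<open>u = 1\<close> the two radii coincide, so no point of the region lies there; the remaining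
  directions form an open arc, and the region is a continuous image of a rectangle.
\<close>

lemma connected_curve_interior: "connected (curve_interior mean_curve)"
proof -
  define f where "f = (\<lambda>(t, a). of_real (inner_radius (cis (2 * pi * t))
    + a * (outer_radius (cis (2 * pi * t)) - inner_radius (cis (2 * pi * t)))) * cis (2 * pi * t))"
  have "curve_interior mean_curve = f ` ({0<..<1} \<times> {0<..<1})"
  proof (intro equalityI subsetI)
    fix s assume s: "s \<in> curve_interior mean_curve"
    obtain r u where ru: "0 \<le> r" "norm u = 1" "s = of_real r * u"
      using outer.polar_decomposition .
    have r: "inner_radius u < r" "r < outer_radius u"
      using s in_curve_interior_iff[OF ru(1,2)] ru(3) by auto
    obtain t where t: "0 \<le> t" "t < 1" "u = cis (2 * pi * t)"
      using outer.unit_vector_as_cis[OF ru(2)] .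
    have "t \<noteq> 0" using r t by (auto simp: inner_radius_def outer_radius_def)
    define a where "a = (r - inner_radius u) / (outer_radius u - inner_radius u)"
    have "0 < a" "a < 1" "inner_radius u + a * (outer_radius u - inner_radius u) = r"
      using r by (auto simp: a_def field_simps)
    then show "s \<in> f ` ({0<..<1} \<times> {0<..<1})"
      using t \<open>t \<noteq> 0\<close> ru by (intro image_eqI[of _ _ "(t, a)"]) (auto simp: f_def)
  next
    fix s assume "s \<in> f ` ({0<..<1} \<times> {0<..<1})"
    then obtain t a where ta: "0 < t" "t < 1" "0 < a" "a < 1" "s = f (t, a)" by auto
    define u where "u = cis (2 * pi * t)"
    have u: "norm u = 1" by (simp add: u_def)
    have "u \<noteq> 1"
    proof
      assume "u = 1"
      then have "cos (2 * pi * t) = 1" by (simp add: u_def complex_eq_iff)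
      then obtain n :: int where "2 * pi * t = of_int n * 2 * pi"
        unfolding cos_one_2pi_int by blast
      then have "t = of_int n" by simp
      then show False using ta by simp
    qed
    define d where "d = outer_radius u - inner_radius u"
    have d: "0 < d" using inner_less_outer[OF u \<open>u \<noteq> 1\<close>] by (simp add: d_def)
    have "0 < a * d" "a * d < 1 * d"
      using ta d by (auto intro: mult_strict_right_mono)
    then have r: "inner_radius u < inner_radius u + a * d" "inner_radius u + a * d < outer_radius u"
      by (simp_all add: d_def)
    have s: "s = of_real (inner_radius u + a * d) * u"
      using ta by (simp add: f_def u_def d_def)
    show "s \<in> curve_interior mean_curve"
      unfolding s using r inner_radius_pos[OF u] u by (subst in_curve_interior_iff) auto
  qed
  moreover have "continuous_on ({0<..<1} \<times> {0<..<1}) f"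
  proof -
    have c: "continuous_on A (\<lambda>p. cis (2 * pi * fst p))" for A :: "(real \<times> real) set"
      by (intro continuous_intros)
    have "continuous_on A (\<lambda>p. \<rho> (cis (2 * pi * fst p)))"
      if "continuous_on UNIV \<rho>" for A :: "(real \<times> real) set" and \<rho> :: "complex \<Rightarrow> real"
      by (rule continuous_on_compose2[OF that c]) auto
    note this[OF continuous_on_radii(1)] this[OF continuous_on_radii(2)]
    then show ?thesis unfolding f_def case_prod_unfold by (intro continuous_intros)
  qed
  moreover have "connected ({0<..<1::real} \<times> {0<..<1::real})"
    by (intro connected_Times) auto
  ultimately show ?thesis using connected_continuous_image by metis
qed

text \<open>
  A connected set avoiding the curve cannot leave the region, since the winding number would change
  along the way.
\<close>

lemma curve_interior_component:
  "curve_interior mean_curve \<in> components (- path_image mean_curve)"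
proof -
  \<comment> \<open>Any direction other than \<open>1\<close> provides a point of the region.\<close>
  have "inner_radius (- 1) < outer_radius (- 1)" by (intro inner_less_outer) auto
  then obtain r where "inner_radius (- 1) < r" "r < outer_radius (- 1)" using dense by blast
  then have "of_real r * (- 1) \<in> curve_interior mean_curve"
    using inner_radius_pos[of "- 1"] by (subst in_curve_interior_iff) auto
  moreover have "D \<subseteq> curve_interior mean_curve"
    if D: "connected D" "D \<subseteq> - path_image mean_curve" and z: "z \<in> D" "z \<in> curve_interior mean_curve"
    for D z
  proof
    fix w assume "w \<in> D"
    then have "winding_number mean_curve w = winding_number mean_curve z"
      using D z closed_mean_curve by (intro winding_number_eq[of _ w D z]) (auto simp: closed_curve_def)
    then show "w \<in> curve_interior mean_curve"
      using z D \<open>w \<in> D\<close> by (auto simp: curve_interior_def)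
  qed
  moreover have "curve_interior mean_curve \<subseteq> - path_image mean_curve"
    by (auto simp: curve_interior_def)
  ultimately show ?thesis
    unfolding in_components_maximal using connected_curve_interior by blast
qed

lemma bounded_curve_interior: "bounded (curve_interior mean_curve)"
proof -
  have "bounded (inside (path_image outer.loop))"
    by (intro bounded_inside bounded_path_image outer.path_loop)
  then show ?thesis unfolding curve_interior_eq by (rule bounded_subset) blast
qed

lemma exterior_mean_ineq:
  assumes "s \<in> curve_exterior mean_curve" shows "mean_ineq s"
proof -
  obtain r u where "0 \<le> r" "norm u = 1" "s = of_real r * u"
    using outer.polar_decomposition .
  then show ?thesis using assms in_curve_exterior_imp mean_ineq_if_not_between by metis
qed

lemma interior_reverse_ineq:
  assumes "s \<in> curve_interior mean_curve" shows "(norm ((s + 1) / 2))\<^sup>2 \<le> norm s"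
proof -
  obtain r u where "0 \<le> r" "norm u = 1" "s = of_real r * u"
    using outer.polar_decomposition .
  then show ?thesis using assms in_curve_interior_iff reverse_ineq_if_between by metis
qed

section \<open>The real and the imaginary axis\<close>

lemma quadratic_nonneg_iff:
  fixes x p q :: real
  assumes "0 \<le> q"
  shows "0 \<le> (x - p)\<^sup>2 - q \<longleftrightarrow> x \<le> p - sqrt q \<or> p + sqrt q \<le> x"
proof -
  have "0 \<le> (x - p)\<^sup>2 - q \<longleftrightarrow> (sqrt q)\<^sup>2 \<le> (x - p)\<^sup>2" using assms by simp
  also have "\<dots> \<longleftrightarrow> sqrt q \<le> \<bar>x - p\<bar>" using assms by (simp add: abs_le_square_iff[symmetric] del: real_sqrt_pow2)
  finally show ?thesis by (auto simp: abs_if)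
qed

text \<open>
  For \<open>x \<ge> 0\<close> the inequality is the square \<open>(x - 1)\<^sup>2 \<ge> 0\<close>; for \<open>x < 0\<close> it becomes \<open>(x + 3)\<^sup>2 \<ge> 8\<close>.
\<close>

lemma mean_ineq_real_iff:
  "mean_ineq (of_real x) \<longleftrightarrow> x \<le> -3 - 2 * sqrt 2 \<or> -3 + 2 * sqrt 2 \<le> x"
proof -
  have "norm ((of_real x + 1) / 2 :: complex) = \<bar>x + 1\<bar> / 2"
    using norm_of_real[of "(x + 1) / 2", where 'a = complex] by simp
  then have m: "mean_ineq (of_real x) \<longleftrightarrow> 4 * \<bar>x\<bar> \<le> (x + 1)\<^sup>2"
    by (simp add: mean_ineq_def power_divide mult.commute)
  have s8: "sqrt 8 = 2 * sqrt 2" by (rule real_sqrt_unique) (auto simp: power_mult_distrib)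
  show ?thesis
  proof (cases "0 \<le> x")
    case True
    have "(x + 1)\<^sup>2 - 4 * \<bar>x\<bar> = (x - 1)\<^sup>2"
      using True by (simp add: power2_eq_square algebra_simps)
    then have "mean_ineq (of_real x)" unfolding m using zero_le_power2[of "x - 1"] by linarith
    moreover have "sqrt 2 \<le> 3 / 2" by (rule real_le_lsqrt) (auto simp: power2_eq_square)
    ultimately show ?thesis using True by simp
  next
    case False
    have "(x + 1)\<^sup>2 - 4 * \<bar>x\<bar> = (x - (- 3))\<^sup>2 - 8"
      using False by (simp add: power2_eq_square algebra_simps)
    then show ?thesis
      unfolding m using quadratic_nonneg_iff[of 8 x "- 3"] s8 by auto
  qed
qed

text \<open>
  On the imaginary axis both sides depend only on \<open>\<bar>Im s\<bar>\<close>, and the inequality is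
  \<open>(\<bar>Im s\<bar> - 2)\<^sup>2 \<ge> 3\<close>.
\<close>

lemma mean_ineq_imaginary_iff:
  assumes "Re s = 0"
  shows "mean_ineq s \<longleftrightarrow> \<bar>Im s\<bar> \<le> 2 - sqrt 3 \<or> 2 + sqrt 3 \<le> \<bar>Im s\<bar>"
proof -
  have "norm s = \<bar>Im s\<bar>" using assms by (simp add: cmod_def)
  moreover have "(norm ((s + 1) / 2))\<^sup>2 = (1 + \<bar>Im s\<bar>\<^sup>2) / 4"
    using assms by (simp add: norm_divide power_divide cmod_power2)
  ultimately have "mean_ineq s \<longleftrightarrow> 0 \<le> (\<bar>Im s\<bar> - 2)\<^sup>2 - 3"
    by (simp add: mean_ineq_def power2_diff field_simps)
  then show ?thesis using quadratic_nonneg_iff[of 3 "\<bar>Im s\<bar>" 2] by simp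
qed

theorem mainTheorem1:
  shows
    "(\<exists>\<gamma> outer inner :: real \<Rightarrow> complex.
        closed_curve \<gamma> \<and> bounded (path_image \<gamma>) \<and>
        path_image \<gamma> = {s. norm s = (norm ((s + 1) / 2))\<^sup>2} \<and>
        (\<forall>s \<in> curve_exterior \<gamma>. mean_ineq s) \<and>
        (\<forall>s \<in> curve_interior \<gamma>. norm s \<ge> (norm ((s + 1) / 2))\<^sup>2) \<and>
        curve_interior \<gamma> \<in> components (- path_image \<gamma>) \<and> bounded (curve_interior \<gamma>) \<and>
        (\<forall>x y :: real. Complex x y \<in> path_image \<gamma> \<longleftrightarrow>
           x^4 + y^4 + 2 * x^2 * y^2 + 4 * x^3 + 4 * x * y^2 - 10 * x^2 - 14 * y^2 + 4 * x + 1 = 0) \<and>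
        simple_path outer \<and> closed_curve outer \<and>
        simple_path inner \<and> closed_curve inner \<and>
        path_image \<gamma> = path_image outer \<union> path_image inner \<and>
        curve_interior \<gamma> = inside (path_image outer) \<inter> outside (path_image inner) \<and>
        inside (path_image inner) \<subseteq> inside (path_image outer) \<and>
        (\<forall>r \<phi> :: real. r \<ge> 0 \<longrightarrow>
           (of_real r * exp (\<i> * of_real \<phi>) \<in> path_image outer \<longleftrightarrow>
              r = 2 - cos \<phi> + sqrt ((2 - cos \<phi>)\<^sup>2 - 1)) \<and>
           (of_real r * exp (\<i> * of_real \<phi>) \<in> path_image inner \<longleftrightarrow>
              r = 2 - cos \<phi> - sqrt ((2 - cos \<phi>)\<^sup>2 - 1)))) \<and>
     {x :: real. mean_ineq (of_real x)} = {.. -3 - 2 * sqrt 2} \<union> {-3 + 2 * sqrt 2 ..} \<and>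
     {0 :: real <..} \<subset> {x :: real. mean_ineq (of_real x)} \<and>
     (\<forall>s. Re s = 0 \<longrightarrow>
        (mean_ineq s \<longleftrightarrow>
           Im s \<in> {.. -2 - sqrt 3} \<union> {-2 + sqrt 3 .. 2 - sqrt 3} \<union> {2 + sqrt 3 ..}))"
proof (intro conjI)
  have "(\<forall>r \<phi> :: real. r \<ge> 0 \<longrightarrow>
           (of_real r * exp (\<i> * of_real \<phi>) \<in> path_image outer.loop \<longleftrightarrow>
              r = 2 - cos \<phi> + sqrt ((2 - cos \<phi>)\<^sup>2 - 1)) \<and>
           (of_real r * exp (\<i> * of_real \<phi>) \<in> path_image inner.loop \<longleftrightarrow>
              r = 2 - cos \<phi> - sqrt ((2 - cos \<phi>)\<^sup>2 - 1)))"
    using outer.in_loop_iff[of _ "cis _"] inner.in_loop_iff[of _ "cis _"]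
    by (simp add: outer_radius_def inner_radius_def flip: cis_conv_exp)
  moreover have "(\<forall>x y :: real. Complex x y \<in> path_image mean_curve \<longleftrightarrow>
      x^4 + y^4 + 2 * x^2 * y^2 + 4 * x^3 + 4 * x * y^2 - 10 * x^2 - 14 * y^2 + 4 * x + 1 = 0)"
    unfolding path_image_mean_curve_eq mem_Collect_eq equality_cartesian by blast
  moreover have "bounded (path_image mean_curve)"
    using closed_mean_curve by (simp add: closed_curve_def bounded_path_image)
  moreover have "closed_curve outer.loop" "closed_curve inner.loop"
    by (simp_all add: closed_curve_def outer.path_loop inner.path_loop outer.loop_closed
        inner.loop_closed)
  moreover have "\<forall>s \<in> curve_exterior mean_curve. mean_ineq s"
    "\<forall>s \<in> curve_interior mean_curve. norm s \<ge> (norm ((s + 1) / 2))\<^sup>2"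
    using exterior_mean_ineq interior_reverse_ineq by blast+
  moreover note closed_mean_curve path_image_mean_curve_eq curve_interior_component
    bounded_curve_interior outer.simple_path_loop inner.simple_path_loop path_image_mean_curve
    curve_interior_eq inside_inner_subset
  ultimately show "(\<exists>\<gamma> outer inner :: real \<Rightarrow> complex.
        closed_curve \<gamma> \<and> bounded (path_image \<gamma>) \<and>
        path_image \<gamma> = {s. norm s = (norm ((s + 1) / 2))\<^sup>2} \<and>
        (\<forall>s \<in> curve_exterior \<gamma>. mean_ineq s) \<and>
        (\<forall>s \<in> curve_interior \<gamma>. norm s \<ge> (norm ((s + 1) / 2))\<^sup>2) \<and>
        curve_interior \<gamma> \<in> components (- path_image \<gamma>) \<and> bounded (curve_interior \<gamma>) \<and>
        (\<forall>x y :: real. Complex x y \<in> path_image \<gamma> \<longleftrightarrow>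
           x^4 + y^4 + 2 * x^2 * y^2 + 4 * x^3 + 4 * x * y^2 - 10 * x^2 - 14 * y^2 + 4 * x + 1 = 0) \<and>
        simple_path outer \<and> closed_curve outer \<and>
        simple_path inner \<and> closed_curve inner \<and>
        path_image \<gamma> = path_image outer \<union> path_image inner \<and>
        curve_interior \<gamma> = inside (path_image outer) \<inter> outside (path_image inner) \<and>
        inside (path_image inner) \<subseteq> inside (path_image outer) \<and>
        (\<forall>r \<phi> :: real. r \<ge> 0 \<longrightarrow>
           (of_real r * exp (\<i> * of_real \<phi>) \<in> path_image outer \<longleftrightarrow>
              r = 2 - cos \<phi> + sqrt ((2 - cos \<phi>)\<^sup>2 - 1)) \<and>
           (of_real r * exp (\<i> * of_real \<phi>) \<in> path_image inner \<longleftrightarrow>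
              r = 2 - cos \<phi> - sqrt ((2 - cos \<phi>)\<^sup>2 - 1))))"
    by (rule_tac exI[of _ mean_curve], rule_tac exI[of _ outer.loop],
        rule_tac exI[of _ inner.loop]) (intro conjI; assumption)
next
  show "{x :: real. mean_ineq (of_real x)} = {.. -3 - 2 * sqrt 2} \<union> {-3 + 2 * sqrt 2 ..}"
    by (auto simp: mean_ineq_real_iff)
next
  have "sqrt 2 < 3 / 2" by (rule real_less_lsqrt) (auto simp: power2_eq_square)
  then have "{0 :: real <..} \<subseteq> {x. mean_ineq (of_real x)}" "mean_ineq (of_real 0)"
    unfolding mean_ineq_real_iff by auto
  then show "{0 :: real <..} \<subset> {x :: real. mean_ineq (of_real x)}"
    by blast
next
  have "sqrt 3 < 2" using real_sqrt_less_mono[of 3 4] by simp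
  then show "\<forall>s. Re s = 0 \<longrightarrow>
      (mean_ineq s \<longleftrightarrow>
         Im s \<in> {.. -2 - sqrt 3} \<union> {-2 + sqrt 3 .. 2 - sqrt 3} \<union> {2 + sqrt 3 ..})"
    by (auto simp: mean_ineq_imaginary_iff abs_if)
qed

end
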